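(* Let $X$ and $Y$ be Hausdorff topological spaces and let $f:X\rightarrow Y$ be a continuous surjection which is both an open map and a closed map. If $X$ is a regular space with a uniform base at non-isolated points, then $Y$ is a regular space with a uniform base at non-isolated points.
   Context: A base $\mathcal{P}$ of a topological space $X$ is called a uniform base at non-isolated points for $X$ if for each non-isolated point $x\in X$ and each countably infinite subset $\mathcal{P}'$ of $\{P\in\mathcal{P}:x\in P\}$, the family $\mathcal{P}'$ is a neighborhood base at $x$ in $X$. All spaces are assumed to be Hausdorff and all maps are continuous and onto. *)

theory Defs
  imports "HOL-Analysis.Analysis"
begin

definition uniform_base_at_nonisolated_points :: "'a topology \<Rightarrow> 'a set set \<Rightarrow> bool"
  where "uniform_base_at_nonisolated_points X \<P> \<longleftrightarrow>
    openin X = arbitrary union_of (\<lambda>U. U \<in> \<P>) \<and>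
    (\<forall>x \<in> topspace X. \<not> openin X {x} \<longrightarrow>
      (\<forall>\<Q>. \<Q> \<subseteq> {P \<in> \<P>. x \<in> P} \<and> countable \<Q> \<and> infinite \<Q>
         \<longrightarrow> neighbourhood_base_at x (\<lambda>U. U \<in> \<Q>) X))"

end

(*
Call a base uniform at x if for every open W containing x only finitely many members containing x
are not contained in W. In such a base the maximal members of any subfamily covering the
non-isolated points form a point-finite cover, and peeling off maximal members repeatedly gives
point-finite covers U(n) of the non-isolated points of X whose stars shrink to the points.
Openness of f makes every fibre over a non-isolated point consist of non-isolated points.

The fibres F(z) need not be compact, so the U(n) cannot simply be pushed forward. Instead, choose
c(z) in F(z) and let h(n,z) consist of the points of all f(u), where c(z) is in u and u is in U(m)
for some m <= n, whose fibres lie in the star of F(z) in U(n). If y is in h(n,z_n) for all n, the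
second condition gives z_n -> y. As f is closed, the points c(z_n) then cluster at a point of F(y),
and the first condition gives that the sets h(n,z_n) shrink to y.

It remains to refine the covers h(n,_) by point-finite ones. A point-finite cover M of X yields the
closure-preserving closed sets C(B), the points lying only in members of B, for finite B <= M; their
images are closure-preserving because f is closed. On Y this suffices for constructing point-finite
refinements, by the development h.
*)

theory Submission
  imports Defs
begin

section \<open>Uniform bases as a finiteness condition\<close>

definition nonisolated :: "'a topology \<Rightarrow> 'a set"
  where "nonisolated X = {x \<in> topspace X. \<not> openin X {x}}"

definition maximal_members :: "'a set set \<Rightarrow> 'a set set"
  where "maximal_members \<S> = {P \<in> \<S>. \<forall>Q\<in>\<S>. P \<subseteq> Q \<longrightarrow> Q = P}"

lemma uniform_base_openin:
  assumes "uniform_base_at_nonisolated_points X \<P>" "P \<in> \<P>"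
  shows "openin X P"
  using assms unfolding uniform_base_at_nonisolated_points_def openin_topology_base_unique by blast

text \<open>Infinitely many members at \<open>x\<close> not contained in \<open>W\<close> would
  include a countably infinite family of them, none of which fits into \<open>W\<close>. Conversely,
  an infinite family of members at \<open>x\<close> cannot be exhausted by the finite exceptional
  set, so one of them lies inside \<open>W\<close>. All later arguments use this finite
  form.\<close>

lemma uniform_base_iff:
  "uniform_base_at_nonisolated_points X \<P> \<longleftrightarrow>
    openin X = arbitrary union_of (\<lambda>U. U \<in> \<P>) \<and>
    (\<forall>x\<in>nonisolated X. \<forall>W. openin X W \<and> x \<in> W \<longrightarrow> finite {P \<in> \<P>. x \<in> P \<and> \<not> P \<subseteq> W})"
    (is "?L \<longleftrightarrow> ?base \<and> ?fin")
proof
  assume L: ?L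
  have "finite {P \<in> \<P>. x \<in> P \<and> \<not> P \<subseteq> W}"
    if x: "x \<in> nonisolated X" and W: "openin X W" "x \<in> W" for x W
  proof (rule ccontr)
    assume "infinite {P \<in> \<P>. x \<in> P \<and> \<not> P \<subseteq> W}"
    then obtain \<Q> where Q: "\<Q> \<subseteq> {P \<in> \<P>. x \<in> P \<and> \<not> P \<subseteq> W}" "countable \<Q>" "infinite \<Q>"
      using infinite_countable_subset' by blast
    then have "neighbourhood_base_at x (\<lambda>U. U \<in> \<Q>) X"
      using L x unfolding uniform_base_at_nonisolated_points_def nonisolated_def by blast
    then obtain V where "V \<in> \<Q>" "V \<subseteq> W"
      using W unfolding neighbourhood_base_at_def by metis
    with Q show False by blast
  qed
  with L show "?base \<and> ?fin"
    unfolding uniform_base_at_nonisolated_points_def by blast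
next
  assume R: "?base \<and> ?fin"
  have "neighbourhood_base_at x (\<lambda>U. U \<in> \<Q>) X"
    if x: "x \<in> topspace X" "\<not> openin X {x}"
      and Q: "\<Q> \<subseteq> {P \<in> \<P>. x \<in> P}" "infinite \<Q>" for x \<Q>
    unfolding neighbourhood_base_at_def
  proof (intro allI impI)
    fix W assume W: "openin X W \<and> x \<in> W"
    with R x have "finite {P \<in> \<P>. x \<in> P \<and> \<not> P \<subseteq> W}"
      by (simp add: nonisolated_def)
    with Q have "\<not> \<Q> \<subseteq> {P \<in> \<P>. x \<in> P \<and> \<not> P \<subseteq> W}"
      using finite_subset by blast
    with Q obtain P where P: "P \<in> \<Q>" "P \<subseteq> W" by blast
    moreover have "openin X P"
      using R P Q unfolding openin_topology_base_unique by blast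
    ultimately show "\<exists>U V. openin X U \<and> V \<in> \<Q> \<and> x \<in> U \<and> U \<subseteq> V \<and> V \<subseteq> W"
      using Q by blast
  qed
  with R show ?L
    unfolding uniform_base_at_nonisolated_points_def by blast
qed

lemma uniform_base_finite:
  assumes "uniform_base_at_nonisolated_points X \<P>" "x \<in> nonisolated X" "openin X W" "x \<in> W"
  shows "finite {P \<in> \<P>. x \<in> P \<and> \<not> P \<subseteq> W}"
  using assms by (simp add: uniform_base_iff)

lemma uniform_base_inside:
  assumes "uniform_base_at_nonisolated_points X \<P>" "openin X W" "x \<in> W"
  obtains P where "P \<in> \<P>" "x \<in> P" "P \<subseteq> W"
  using assms unfolding uniform_base_at_nonisolated_points_def openin_topology_base_unique by blast

text \<open>Finitely many members at \<open>x\<close> would have an open intersection, and T1 would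
  shrink it to \<open>{x}\<close>, making \<open>x\<close> isolated. This infinity keeps the
  repeated removal of maximal members from exhausting the base at \<open>x\<close>.\<close>

lemma uniform_base_infinite:
  assumes P: "uniform_base_at_nonisolated_points X \<P>" and "t1_space X" and x: "x \<in> nonisolated X"
  shows "infinite {P \<in> \<P>. x \<in> P}"
proof
  let ?Px = "{P \<in> \<P>. x \<in> P}"
  assume fin: "finite ?Px"
  have xX: "x \<in> topspace X" using x by (simp add: nonisolated_def)
  have ne: "?Px \<noteq> {}"
    using uniform_base_inside[OF P openin_topspace xX] by blast
  have "openin X (\<Inter>?Px)"
    using fin ne by (intro openin_Inter) (auto intro: uniform_base_openin[OF P])
  moreover have "\<Inter>?Px = {x}"
  proof (intro equalityI subsetI)
    fix z assume z: "z \<in> \<Inter>?Px"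
    then have zX: "z \<in> topspace X"
      using ne uniform_base_openin[OF P] openin_subset by blast
    show "z \<in> {x}"
    proof (rule ccontr)
      assume "z \<notin> {x}"
      moreover have "openin X (topspace X - {z})"
        using \<open>t1_space X\<close> zX by (simp add: t1_space_closedin_singleton openin_diff)
      ultimately obtain P where "P \<in> \<P>" "x \<in> P" "P \<subseteq> topspace X - {z}"
        using uniform_base_inside[OF P, of "topspace X - {z}" x] xX by blast
      with z show False by blast
    qed
  qed auto
  ultimately show False using x by (simp add: nonisolated_def)
qed

section \<open>Maximal members and a point-finite development of \<open>X\<close>\<close>

lemma maximal_members_subset: "maximal_members \<S> \<subseteq> \<S>"
  by (auto simp: maximal_members_def)

text \<open>A member properly containing \<open>S\<close> is not contained in \<open>S\<close>. As
  \<open>S\<close> is an open set around \<open>x\<close>, only finitely many such members exist, so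
  a maximal one among them can be picked.\<close>

lemma maximal_members_cover:
  assumes P: "uniform_base_at_nonisolated_points X \<P>" and S: "\<S> \<subseteq> \<P>"
    and x: "x \<in> nonisolated X" "x \<in> S" "S \<in> \<S>"
  obtains M where "M \<in> maximal_members \<S>" "x \<in> M"
proof -
  let ?T = "{Q \<in> \<S>. S \<subseteq> Q}"
  have "?T \<subseteq> insert S {Q \<in> \<P>. x \<in> Q \<and> \<not> Q \<subseteq> S}"
    using S x by blast
  moreover have "finite {Q \<in> \<P>. x \<in> Q \<and> \<not> Q \<subseteq> S}"
    using uniform_base_finite[OF P x(1) _ x(2)] uniform_base_openin[OF P] S x by blast
  ultimately have "finite ?T"
    by (meson finite_insert finite_subset)
  then obtain M where M: "M \<in> ?T" "\<And>Q. Q \<in> ?T \<Longrightarrow> M \<subseteq> Q \<Longrightarrow> M = Q"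
    using finite_has_maximal[of ?T] x by blast
  then have "M \<in> maximal_members \<S>"
    unfolding maximal_members_def by blast
  with M x that show thesis by blast
qed

text \<open>Distinct maximal members are incomparable: once \<open>M\<close> contains
  \<open>x\<close>, every other one through \<open>x\<close> is among the finitely many base members
  at \<open>x\<close> not contained in \<open>M\<close>.\<close>

lemma maximal_members_point_finite:
  assumes P: "uniform_base_at_nonisolated_points X \<P>" and S: "\<S> \<subseteq> \<P>"
    and x: "x \<in> nonisolated X"
  shows "finite {M \<in> maximal_members \<S>. x \<in> M}"
proof (cases "{M \<in> maximal_members \<S>. x \<in> M} = {}")
  case False
  then obtain M where M: "M \<in> maximal_members \<S>" "x \<in> M" by blast
  then have "{M \<in> maximal_members \<S>. x \<in> M} \<subseteq> insert M {Q \<in> \<P>. x \<in> Q \<and> \<not> Q \<subseteq> M}"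
    using S unfolding maximal_members_def by blast
  moreover have "M \<in> \<P>" using M S maximal_members_subset by blast
  then have "finite {Q \<in> \<P>. x \<in> Q \<and> \<not> Q \<subseteq> M}"
    using uniform_base_finite[OF P x] uniform_base_openin[OF P] M by blast
  ultimately show ?thesis
    by (meson finite_insert finite_subset)
qed (metis finite.emptyI)

text \<open>\<open>\<S> n\<close> is what remains of the base after n rounds of removing all maximal
  members, and \<open>\<U> n\<close> is what the next round removes. Each round takes finitely many
  of the infinitely many members at a non-isolated point, so every \<open>\<U> n\<close> still
  covers these points.\<close>

lemma uniform_base_development:
  fixes X :: "'a topology"
  assumes P: "uniform_base_at_nonisolated_points X \<P>" and t1: "t1_space X"
  obtains \<U> :: "nat \<Rightarrow> 'a set set" where
    "\<And>n u. u \<in> \<U> n \<Longrightarrow> openin X u"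
    "\<And>n x. x \<in> nonisolated X \<Longrightarrow> \<exists>u\<in>\<U> n. x \<in> u"
    "\<And>n x. x \<in> nonisolated X \<Longrightarrow> finite {u \<in> \<U> n. x \<in> u}"
    "\<And>x W. x \<in> nonisolated X \<Longrightarrow> openin X W \<Longrightarrow> x \<in> W \<Longrightarrow>
        \<exists>N. \<forall>n\<ge>N. \<forall>u\<in>\<U> n. x \<in> u \<longrightarrow> u \<subseteq> W"
proof -
  define \<S> where "\<S> n = ((\<lambda>\<T>. \<T> - maximal_members \<T>) ^^ n) \<P>" for n
  define \<U> where "\<U> n = maximal_members (\<S> n)" for n
  have S0: "\<S> 0 = \<P>" and step: "\<S> (Suc n) = \<S> n - \<U> n" for n
    by (simp_all add: \<S>_def \<U>_def)
  have sub: "\<S> n \<subseteq> \<P>" for n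
    by (induction n) (auto simp: S0 step)
  have US: "\<U> n \<subseteq> \<S> n" for n
    by (simp add: \<U>_def maximal_members_subset)
  have fin: "finite {u \<in> \<U> n. x \<in> u}" if "x \<in> nonisolated X" for n x
    unfolding \<U>_def using maximal_members_point_finite[OF P sub that] .
  have inf: "infinite {u \<in> \<S> n. x \<in> u}" if x: "x \<in> nonisolated X" for n x
  proof (induction n)
    case 0
    then show ?case using uniform_base_infinite[OF P t1 x] by (simp add: S0)
  next
    case (Suc n)
    have "{u \<in> \<S> (Suc n). x \<in> u} = {u \<in> \<S> n. x \<in> u} - {u \<in> \<U> n. x \<in> u}"
      by (auto simp: step)
    with Suc.IH fin[OF x] show ?case by (simp add: Diff_infinite_finite)
  qed
  have anti: "\<S> n \<subseteq> \<S> m" if "m \<le> n" for m n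
    using that by (induction rule: dec_induct) (auto simp: step)
  have disj: "m = n" if "u \<in> \<U> m" "u \<in> \<U> n" for u m n
  proof -
    have False if "i < j" "u \<in> \<U> i" "u \<in> \<U> j" for i j
      using that anti[of "Suc i" j] US[of j] by (auto simp: step)
    with that show ?thesis by (metis linorder_neqE_nat)
  qed
  show thesis
  proof (rule that[of \<U>])
    show "openin X u" if "u \<in> \<U> n" for n u
      using that US sub uniform_base_openin[OF P] by blast
    show "\<exists>u\<in>\<U> n. x \<in> u" if x: "x \<in> nonisolated X" for n x
    proof -
      obtain S where "S \<in> \<S> n" "x \<in> S"
        using inf[OF x, of n] by (metis (no_types, lifting) empty_Collect_eq finite.emptyI)
      with maximal_members_cover[OF P sub x] show ?thesis
        unfolding \<U>_def by metis
    qed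
    show "finite {u \<in> \<U> n. x \<in> u}" if "x \<in> nonisolated X" for n x
      using fin that .
    show "\<exists>N. \<forall>n\<ge>N. \<forall>u\<in>\<U> n. x \<in> u \<longrightarrow> u \<subseteq> W"
      if x: "x \<in> nonisolated X" and W: "openin X W" "x \<in> W" for x W
    proof -
      let ?B = "{P \<in> \<P>. x \<in> P \<and> \<not> P \<subseteq> W}"
      \<comment> \<open>Each member is removed in at most one round, so the finitely many members at
        \<open>x\<close> that leave \<open>W\<close> occupy only finitely many rounds;
        \<open>N\<close> lies beyond all of them.\<close>
      have "finite {n. u \<in> \<U> n}" for u
      proof (cases "\<exists>n. u \<in> \<U> n")
        case True
        then obtain n where "u \<in> \<U> n" ..
        then have "{n. u \<in> \<U> n} \<subseteq> {n}" using disj by blast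
        then show ?thesis using finite_subset by blast
      qed simp
      then have "finite (\<Union>u\<in>?B. {n. u \<in> \<U> n})"
        using uniform_base_finite[OF P x W] by blast
      then obtain N where N: "\<forall>n\<in>(\<Union>u\<in>?B. {n. u \<in> \<U> n}). n < N"
        using finite_nat_set_iff_bounded by blast
      have "u \<subseteq> W" if "N \<le> n" "u \<in> \<U> n" "x \<in> u" for n u
      proof (rule ccontr)
        assume "\<not> u \<subseteq> W"
        then have "u \<in> ?B" using that US sub by blast
        with N that show False by force
      qed
      then show ?thesis by blast
    qed
  qed
qed

section \<open>Point-finite refinements from closure-preserving closed covers\<close>

text \<open>The condition in the next definition is the one that Junnila showed to characterise
  metacompactness; unlike point-finiteness it obviously passes to closed images.\<close>

definition closure_preserving_refinable :: "'a topology \<Rightarrow> 'a set \<Rightarrow> bool"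
  where "closure_preserving_refinable Y D \<longleftrightarrow>
    (\<forall>\<V>. (\<forall>v\<in>\<V>. openin Y v) \<and> D \<subseteq> \<Union>\<V> \<longrightarrow>
      (\<exists>\<K>. D \<subseteq> \<Union>\<K> \<and> (\<forall>\<K>'\<subseteq>\<K>. closedin Y (\<Union>\<K>')) \<and>
        (\<forall>k\<in>\<K>. \<exists>\<A>\<subseteq>\<V>. finite \<A> \<and> k \<subseteq> \<Union>\<A>)))"

lemma closure_preserving_refinableE:
  assumes "closure_preserving_refinable Y D" "\<And>v. v \<in> \<V> \<Longrightarrow> openin Y v" "D \<subseteq> \<Union>\<V>"
  obtains \<K> where "D \<subseteq> \<Union>\<K>" "\<And>\<K>'. \<K>' \<subseteq> \<K> \<Longrightarrow> closedin Y (\<Union>\<K>')"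
    "\<And>k. k \<in> \<K> \<Longrightarrow> \<exists>\<A>\<subseteq>\<V>. finite \<A> \<and> k \<subseteq> \<Union>\<A>"
proof -
  have "\<exists>\<K>. D \<subseteq> \<Union>\<K> \<and> (\<forall>\<K>'\<subseteq>\<K>. closedin Y (\<Union>\<K>')) \<and>
        (\<forall>k\<in>\<K>. \<exists>\<A>\<subseteq>\<V>. finite \<A> \<and> k \<subseteq> \<Union>\<A>)"
    using assms unfolding closure_preserving_refinable_def by blast
  then obtain \<K> where K: "D \<subseteq> \<Union>\<K>" "\<forall>\<K>'\<subseteq>\<K>. closedin Y (\<Union>\<K>')"
    "\<forall>k\<in>\<K>. \<exists>\<A>\<subseteq>\<V>. finite \<A> \<and> k \<subseteq> \<Union>\<A>" by (elim exE conjE)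
  show thesis by (rule that[of \<K>]) (use K in simp_all)
qed

text \<open>For each \<open>m\<close>, sets \<open>H m v\<close> inside the members \<open>v\<close>
  form an open family that is point-finite on \<open>D\<close>; over all \<open>m\<close> they cover
  \<open>D\<close>. A second use of \<open>cp\<close>, on the increasing unions \<open>G n\<close>,
  cuts these countably many families down to a single point-finite one.\<close>

lemma point_finite_refinement:
  fixes Y :: "'b topology" and g :: "nat \<Rightarrow> 'b \<Rightarrow> 'b set"
  assumes cp: "closure_preserving_refinable Y D"
    and g: "\<And>n z. z \<in> D \<Longrightarrow> openin Y (g n z)" "\<And>n z. z \<in> D \<Longrightarrow> z \<in> g n z"
    and dev: "\<And>y W. y \<in> D \<Longrightarrow> openin Y W \<Longrightarrow> y \<in> W \<Longrightarrow>
      \<exists>N. \<forall>n\<ge>N. \<forall>z\<in>D. y \<in> g n z \<longrightarrow> g n z \<subseteq> W"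
    and V: "\<And>v. v \<in> \<V> \<Longrightarrow> openin Y v" "D \<subseteq> \<Union>\<V>"
  obtains \<R> where "\<And>r. r \<in> \<R> \<Longrightarrow> openin Y r" "\<And>r. r \<in> \<R> \<Longrightarrow> \<exists>v\<in>\<V>. r \<subseteq> v"
    "D \<subseteq> \<Union>\<R>" "\<And>y. y \<in> D \<Longrightarrow> finite {r \<in> \<R>. y \<in> r}"
proof -
  obtain wo :: "'b set rel" where wo: "well_order_on UNIV wo"
    using well_order_on by blast
  \<comment> \<open>\<open>E m v\<close> collects the points whose first member of
    \<open>\<V>\<close> in the well-order is \<open>v\<close> and for which stage \<open>m\<close>
    of the development is already fine enough to stay inside \<open>v\<close>.\<close>
  define E where "E m v = {y \<in> D. (\<forall>v'\<in>\<V>. (v', v) \<in> wo - Id \<longrightarrow> y \<notin> v') \<and>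
      (\<forall>z\<in>D. y \<in> g m z \<longrightarrow> g m z \<subseteq> v)}" for m v
  have E_cover: "\<exists>m. \<exists>v\<in>\<V>. y \<in> E m v" if y: "y \<in> D" for y
  proof -
    have wf: "wf (wo - Id)" using wo by (simp add: well_order_on_def)
    obtain v0 where "v0 \<in> {v \<in> \<V>. y \<in> v}" using V y by blast
    then obtain v where v: "v \<in> \<V>" "y \<in> v" "\<And>v'. (v', v) \<in> wo - Id \<Longrightarrow> v' \<in> \<V> \<Longrightarrow> y \<notin> v'"
      using wfE_min[OF wf] by (metis (mono_tags, lifting) mem_Collect_eq)
    then obtain m where "\<forall>z\<in>D. y \<in> g m z \<longrightarrow> g m z \<subseteq> v"
      using dev[OF y V(1)[OF v(1)] v(2)] by blast
    then have "y \<in> E m v" using y v by (auto simp: E_def)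
    with v show ?thesis by blast
  qed
  have E_sub: "E m v \<subseteq> v" for m v
    using g(2) unfolding E_def by blast
  \<comment> \<open>If \<open>g m z\<close> meets \<open>E m v\<close>, then it lies in
    \<open>v\<close>; so it cannot meet \<open>E m v'\<close> for a later \<open>v'\<close>, whose
    points avoid \<open>v\<close>.\<close>
  have E_discrete: "v = v'"
    if "z \<in> D" "v \<in> \<V>" "v' \<in> \<V>" "g m z \<inter> E m v \<noteq> {}" "g m z \<inter> E m v' \<noteq> {}" for m z v v'
  proof (rule ccontr)
    assume ne: "v \<noteq> v'"
    have "total wo" using wo by (simp add: well_order_on_def linear_order_on_def)
    with ne have "(v, v') \<in> wo - Id \<or> (v', v) \<in> wo - Id"
      by (auto simp: total_on_def)
    with that show False unfolding E_def by blast
  qed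
  have "\<exists>\<K>. D \<subseteq> \<Union>\<K> \<and> (\<forall>\<K>'\<subseteq>\<K>. closedin Y (\<Union>\<K>')) \<and>
        (\<forall>k\<in>\<K>. \<exists>\<A>\<subseteq>g m ` D. finite \<A> \<and> k \<subseteq> \<Union>\<A>)" for m
    by (rule closure_preserving_refinableE[OF cp, of "g m ` D"]) (use g in blast)+
  then obtain K where K: "\<And>m. D \<subseteq> \<Union>(K m)" "\<And>m \<K>'. \<K>' \<subseteq> K m \<Longrightarrow> closedin Y (\<Union>\<K>')"
    "\<And>m k. k \<in> K m \<Longrightarrow> \<exists>\<A>\<subseteq>g m ` D. finite \<A> \<and> k \<subseteq> \<Union>\<A>"
    by metis
  \<comment> \<open>Closure preservation makes the removed union closed. A point of some
    \<open>k\<close> in \<open>K m\<close> can lie in \<open>H m v\<close> only if \<open>k\<close>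
    meets \<open>E m v\<close>; since finitely many \<open>g m z\<close> cover \<open>k\<close>,
    this happens for finitely many \<open>v\<close>.\<close>
  define H where "H m v = v - \<Union>{k \<in> K m. k \<inter> E m v = {}}" for m v
  have H_open: "openin Y (H m v)" if "v \<in> \<V>" for m v
    unfolding H_def using that V(1) by (intro openin_diff K(2)) auto
  have EH: "E m v \<subseteq> H m v" for m v
    using E_sub by (auto simp: H_def)
  have H_fin: "finite {v \<in> \<V>. y \<in> H m v}" if y: "y \<in> D" for y m
  proof -
    obtain k where k: "k \<in> K m" "y \<in> k" using y K(1)[of m] by blast
    then obtain \<A> where A: "\<A> \<subseteq> g m ` D" "finite \<A>" "k \<subseteq> \<Union>\<A>" using K(3)[OF k(1)] by blast
    have "finite {v \<in> \<V>. a \<inter> E m v \<noteq> {}}" if a: "a \<in> \<A>" for a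
    proof (cases "{v \<in> \<V>. a \<inter> E m v \<noteq> {}} = {}")
      case False
      then obtain v where v: "v \<in> \<V>" "a \<inter> E m v \<noteq> {}" by blast
      obtain z where "z \<in> D" "a = g m z" using a A(1) by blast
      with v have "{v \<in> \<V>. a \<inter> E m v \<noteq> {}} \<subseteq> {v}"
        using E_discrete by blast
      then show ?thesis using finite_subset by blast
    qed (metis finite.emptyI)
    then have "finite (\<Union>a\<in>\<A>. {v \<in> \<V>. a \<inter> E m v \<noteq> {}})" using A by blast
    moreover have "{v \<in> \<V>. y \<in> H m v} \<subseteq> (\<Union>a\<in>\<A>. {v \<in> \<V>. a \<inter> E m v \<noteq> {}})"
    proof
      fix v assume v: "v \<in> {v \<in> \<V>. y \<in> H m v}"
      then have "k \<inter> E m v \<noteq> {}" using k by (auto simp: H_def)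
      then obtain a where "a \<in> \<A>" "a \<inter> E m v \<noteq> {}" using A(3) by blast
      with v show "v \<in> (\<Union>a\<in>\<A>. {v \<in> \<V>. a \<inter> E m v \<noteq> {}})" by auto
    qed
    ultimately show ?thesis using finite_subset by blast
  qed
  define G where "G n = (\<Union>m\<le>n. \<Union>v\<in>\<V>. H m v)" for n :: nat
  have G_mono: "G m \<subseteq> G n" if "m \<le> n" for m n
    using that order_trans unfolding G_def by fastforce
  have G_cover: "\<exists>n. y \<in> G n" if "y \<in> D" for y
    using E_cover[OF that] EH unfolding G_def by blast
  have "openin Y (G n)" for n
    unfolding G_def using H_open by blast
  then have G_open: "openin Y v" if "v \<in> range G" for v using that by blast
  have GD: "D \<subseteq> \<Union>(range G)" using G_cover by blast
  obtain L where L: "D \<subseteq> \<Union>L" "\<And>\<K>'. \<K>' \<subseteq> L \<Longrightarrow> closedin Y (\<Union>\<K>')"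
    "\<And>k. k \<in> L \<Longrightarrow> \<exists>\<A>\<subseteq>range G. finite \<A> \<and> k \<subseteq> \<Union>\<A>"
    by (rule closure_preserving_refinableE[OF cp G_open GD]) (assumption | rule that)+
  \<comment> \<open>The sets \<open>G n\<close> increase, so a finite union of them is contained in
    a single one.\<close>
  have L_sub: "\<exists>n. k \<subseteq> G n" if k: "k \<in> L" for k
  proof -
    obtain \<A> where A: "\<A> \<subseteq> range G" "finite \<A>" "k \<subseteq> \<Union>\<A>" using L(3)[OF k] by blast
    then obtain I where I: "finite I" "\<A> = G ` I"
      by (metis finite_subset_image subset_UNIV)
    then obtain n where "\<forall>i\<in>I. i \<le> n" using finite_nat_set_iff_bounded_le by blast
    then have "\<Union>\<A> \<subseteq> G n" using I G_mono by blast
    with A show ?thesis by blast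
  qed
  \<comment> \<open>A point of some \<open>k\<close> in \<open>L\<close> with \<open>k\<close>
    inside \<open>G j\<close> lies in \<open>T n\<close> only for \<open>n \<le> j\<close>, which
    leaves finitely many stages at each point. Conversely, if \<open>n\<close> is the first index
    with \<open>y\<close> in \<open>G n\<close>, no removed set contains \<open>y\<close>.\<close>
  define T where "T n = topspace Y - \<Union>{k \<in> L. \<exists>j<n. k \<subseteq> G j}" for n
  have T_open: "openin Y (T n)" for n
    unfolding T_def by (intro openin_diff L(2)) auto
  define \<R> where "\<R> = (\<Union>n. (\<lambda>v. T n \<inter> H n v) ` \<V>)"
  show thesis
  proof (rule that[of \<R>])
    show "openin Y r" if "r \<in> \<R>" for r
      using that T_open H_open unfolding \<R>_def by blast
    show "\<exists>v\<in>\<V>. r \<subseteq> v" if "r \<in> \<R>" for r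
      using that unfolding \<R>_def H_def by blast
    show "D \<subseteq> \<Union>\<R>"
    proof
      fix y assume y: "y \<in> D"
      define n where "n = (LEAST n. y \<in> G n)"
      have n: "y \<in> G n" and least: "\<And>j. j < n \<Longrightarrow> y \<notin> G j"
        using G_cover[OF y] not_less_Least unfolding n_def by (auto intro: LeastI_ex)
      then obtain m v where mv: "m \<le> n" "v \<in> \<V>" "y \<in> H m v" unfolding G_def by blast
      then have "y \<in> G m" unfolding G_def by blast
      with least mv have "m = n" by (metis le_neq_implies_less)
      moreover have "y \<in> T n"
        using least openin_subset[OF H_open] mv unfolding T_def by blast
      ultimately show "y \<in> \<Union>\<R>" using mv unfolding \<R>_def by blast
    qed
    show "finite {r \<in> \<R>. y \<in> r}" if y: "y \<in> D" for y
    proof -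
      obtain k j where k: "k \<in> L" "y \<in> k" "k \<subseteq> G j" using L(1) L_sub y by blast
      then have "n \<le> j" if "y \<in> T n" for n
        using that unfolding T_def by (metis (mono_tags, lifting) DiffD2 UnionI linorder_not_less mem_Collect_eq)
      then have "{r \<in> \<R>. y \<in> r} \<subseteq> (\<Union>n\<le>j. (\<lambda>v. T n \<inter> H n v) ` {v \<in> \<V>. y \<in> H n v})"
        unfolding \<R>_def by blast
      moreover have "finite (\<Union>n\<le>j. (\<lambda>v. T n \<inter> H n v) ` {v \<in> \<V>. y \<in> H n v})"
        using H_fin[OF y] by blast
      ultimately show ?thesis using finite_subset by blast
    qed
  qed
qed

section \<open>Refinability of covers of the image\<close>

lemma closedin_nonisolated: "closedin X (nonisolated X)"
proof -
  have "topspace X - nonisolated X = \<Union>{{x} |x. openin X {x}}"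
    by (auto simp: nonisolated_def dest: openin_subset)
  moreover have "openin X (\<Union>{{x} |x. openin X {x}})" by blast
  ultimately show ?thesis
    by (auto simp: closedin_def nonisolated_def)
qed

text \<open>An open map sends isolated points to isolated points. Hence the finiteness of the base
  is available on the whole fibre over a non-isolated point.\<close>

lemma nonisolated_if_open_map:
  assumes "open_map X Y f" "x \<in> topspace X" "f x \<in> nonisolated Y"
  shows "x \<in> nonisolated X"
proof -
  have "openin Y {f x}" if "openin X {x}"
    using assms(1) that unfolding open_map_def by (metis image_empty image_insert)
  with assms show ?thesis by (auto simp: nonisolated_def)
qed

text \<open>Point-finiteness may be lost under \<open>f\<close>, but forming unions commutes with
  taking images, so closure preservation survives a closed map. The cover is therefore pulled back,
  made point-finite in \<open>X\<close>, turned into closed sets there, and only then mapped to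
  \<open>Y\<close>.\<close>

lemma closure_preserving_refinable_image:
  assumes P: "uniform_base_at_nonisolated_points X \<P>"
    and f: "continuous_map X Y f" "f ` topspace X = topspace Y" "open_map X Y f" "closed_map X Y f"
  shows "closure_preserving_refinable Y (nonisolated Y)"
  unfolding closure_preserving_refinable_def
proof (intro allI impI, elim conjE)
  fix \<V> assume V: "\<forall>v\<in>\<V>. openin Y v" "nonisolated Y \<subseteq> \<Union>\<V>"
  define \<M> where "\<M> = maximal_members {P \<in> \<P>. \<exists>v\<in>\<V>. f ` P \<subseteq> v}"
  define Z where "Z = {x \<in> topspace X. f x \<in> nonisolated Y}"
  have Zclosed: "closedin X Z"
    unfolding Z_def using closedin_continuous_map_preimage[OF f(1) closedin_nonisolated] .
  have Zn: "x \<in> nonisolated X" if "x \<in> Z" for x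
    using that nonisolated_if_open_map[OF f(3)] by (simp add: Z_def)
  have Msub: "\<M> \<subseteq> {P \<in> \<P>. \<exists>v\<in>\<V>. f ` P \<subseteq> v}"
    unfolding \<M>_def by (rule maximal_members_subset)
  have Mopen: "openin X u" if "u \<in> \<M>" for u
    using that Msub uniform_base_openin[OF P] by blast
  have Mcover: "\<exists>u\<in>\<M>. x \<in> u" if x: "x \<in> Z" for x
  proof -
    obtain v where v: "v \<in> \<V>" "f x \<in> v" using V x by (auto simp: Z_def)
    have "openin X {x \<in> topspace X. f x \<in> v}"
      using openin_continuous_map_preimage[OF f(1)] V v by blast
    then obtain S where "S \<in> \<P>" "x \<in> S" "S \<subseteq> {x \<in> topspace X. f x \<in> v}"
      using uniform_base_inside[OF P] v x by (metis (mono_tags, lifting) Z_def mem_Collect_eq)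
    then have "S \<in> {P \<in> \<P>. \<exists>v\<in>\<V>. f ` P \<subseteq> v}" "x \<in> S" using v by auto
    then show ?thesis
      using maximal_members_cover[OF P _ Zn[OF x]] unfolding \<M>_def
      by (metis (no_types, lifting) mem_Collect_eq subsetI)
  qed
  have Mfin: "finite {u \<in> \<M>. x \<in> u}" if "x \<in> Z" for x
    unfolding \<M>_def using maximal_members_point_finite[OF P _ Zn[OF that]] by simp
  define C where "C B = {x \<in> Z. {u \<in> \<M>. x \<in> u} \<subseteq> B}" for B
  have Cclosed: "closedin X (\<Union>(C ` \<B>))" for \<B>
  proof -
    \<comment> \<open>A point lying in all members of \<open>\<M>\<close> that contain
      \<open>x\<close> belongs to \<open>C B\<close> only if \<open>x\<close> does, when both are in
      \<open>Z\<close>. Hence these finite intersections remove from \<open>Z\<close> exactly the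
      complement of the union, however large \<open>\<B>\<close> is.\<close>
    have "openin X (\<Inter>{u \<in> \<M>. x \<in> u})" if "x \<in> Z" for x
      using Mcover[OF that] Mfin[OF that] Mopen by (intro openin_Inter) auto
    then have "openin X (\<Union>x\<in>Z - \<Union>(C ` \<B>). \<Inter>{u \<in> \<M>. x \<in> u})" by blast
    moreover have "\<Union>(C ` \<B>) = Z - (\<Union>x\<in>Z - \<Union>(C ` \<B>). \<Inter>{u \<in> \<M>. x \<in> u})"
      unfolding C_def by blast
    ultimately show ?thesis
      using Zclosed closedin_diff by metis
  qed
  define \<K> where "\<K> = (\<lambda>B. f ` C B) ` {B. finite B \<and> B \<subseteq> \<M>}"
  have "nonisolated Y \<subseteq> \<Union>\<K>"
  proof
    fix y assume y: "y \<in> nonisolated Y"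
    then have "y \<in> f ` topspace X"
      using f(2) by (simp add: nonisolated_def)
    with y obtain x where x: "x \<in> Z" "f x = y" by (auto simp: Z_def)
    then have "y \<in> f ` C {u \<in> \<M>. x \<in> u}" unfolding C_def by blast
    with Mfin[OF x(1)] show "y \<in> \<Union>\<K>" unfolding \<K>_def by blast
  qed
  moreover have "closedin Y (\<Union>\<K>')" if "\<K>' \<subseteq> \<K>" for \<K>'
  proof -
    obtain \<B> where "\<K>' = (\<lambda>B. f ` C B) ` \<B>"
      using \<open>\<K>' \<subseteq> \<K>\<close> unfolding \<K>_def by (meson subset_imageE)
    then have "\<Union>\<K>' = f ` \<Union>(C ` \<B>)" by blast
    with Cclosed f(4) show ?thesis unfolding closed_map_def by metis
  qed
  moreover have "\<exists>\<A>\<subseteq>\<V>. finite \<A> \<and> k \<subseteq> \<Union>\<A>" if "k \<in> \<K>" for k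
  proof -
    obtain B where B: "finite B" "B \<subseteq> \<M>" "k = f ` C B"
      using \<open>k \<in> \<K>\<close> unfolding \<K>_def by blast
    have "\<forall>u\<in>\<M>. \<exists>v\<in>\<V>. f ` u \<subseteq> v" using Msub by blast
    then obtain w where w: "\<And>u. u \<in> \<M> \<Longrightarrow> w u \<in> \<V> \<and> f ` u \<subseteq> w u" by metis
    have "k \<subseteq> \<Union>(w ` B)"
    proof
      fix y assume "y \<in> k"
      then obtain x where x: "x \<in> C B" "y = f x" using B by blast
      then obtain u where "u \<in> \<M>" "x \<in> u" using Mcover by (auto simp: C_def)
      moreover from this x have "u \<in> B" by (auto simp: C_def)
      ultimately show "y \<in> \<Union>(w ` B)" using w x by blast
    qed
    moreover have "w ` B \<subseteq> \<V>" using B w by blast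
    ultimately show ?thesis using B(1) by blast
  qed
  ultimately show "\<exists>\<K>. nonisolated Y \<subseteq> \<Union>\<K> \<and> (\<forall>\<K>'\<subseteq>\<K>. closedin Y (\<Union>\<K>')) \<and>
        (\<forall>k\<in>\<K>. \<exists>\<A>\<subseteq>\<V>. finite \<A> \<and> k \<subseteq> \<Union>\<A>)"
    by blast
qed

section \<open>A development at the non-isolated points of \<open>Y\<close>\<close>

text \<open>Indexing the sets by a centre \<open>z\<close> allows two steps: \<open>y\<close> in
  \<open>h n z\<close> first forces \<open>z\<close> close to \<open>y\<close>, and then the chosen
  preimage \<open>c z\<close> controls the size of \<open>h n z\<close>. The conclusions are the
  hypotheses on \<open>g\<close> in \<open>point_finite_refinement\<close>.\<close>

lemma development_image:
  fixes X :: "'a topology" and Y :: "'b topology"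
  assumes P: "uniform_base_at_nonisolated_points X \<P>" and t1: "t1_space X"
    and f: "continuous_map X Y f" "f ` topspace X = topspace Y" "open_map X Y f" "closed_map X Y f"
  obtains h :: "nat \<Rightarrow> 'b \<Rightarrow> 'b set" where
    "\<And>n z. z \<in> nonisolated Y \<Longrightarrow> openin Y (h n z)"
    "\<And>n z. z \<in> nonisolated Y \<Longrightarrow> z \<in> h n z"
    "\<And>y W. y \<in> nonisolated Y \<Longrightarrow> openin Y W \<Longrightarrow> y \<in> W \<Longrightarrow>
      \<exists>N. \<forall>n\<ge>N. \<forall>z\<in>nonisolated Y. y \<in> h n z \<longrightarrow> h n z \<subseteq> W"
proof -
  obtain \<U> :: "nat \<Rightarrow> 'a set set" where U_open: "\<And>n u. u \<in> \<U> n \<Longrightarrow> openin X u"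
    and U_cover: "\<And>n x. x \<in> nonisolated X \<Longrightarrow> \<exists>u\<in>\<U> n. x \<in> u"
    and U_fin: "\<And>n x. x \<in> nonisolated X \<Longrightarrow> finite {u \<in> \<U> n. x \<in> u}"
    and U_dev: "\<And>x W. x \<in> nonisolated X \<Longrightarrow> openin X W \<Longrightarrow> x \<in> W \<Longrightarrow>
        \<exists>N. \<forall>n\<ge>N. \<forall>u\<in>\<U> n. x \<in> u \<longrightarrow> u \<subseteq> W"
    by (rule uniform_base_development[OF P t1]) (rule that; assumption)
  define D where "D = nonisolated Y"
  have fib: "x \<in> nonisolated X" if "x \<in> topspace X" "f x \<in> D" for x
    using nonisolated_if_open_map[OF f(3)] that by (simp add: D_def)
  have "D \<subseteq> f ` topspace X"
    using f(2) by (auto simp: D_def nonisolated_def)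
  then have "\<forall>z\<in>D. \<exists>x. x \<in> topspace X \<and> f x = z" by blast
  then obtain c where c: "\<And>z. z \<in> D \<Longrightarrow> c z \<in> topspace X" "\<And>z. z \<in> D \<Longrightarrow> f (c z) = z"
    by metis
  have cn: "c z \<in> nonisolated X" if "z \<in> D" for z
    using fib c that by simp
  define S where "S n z = \<Union>{u \<in> \<U> n. \<exists>x\<in>u. f x = z}" for n z
  \<comment> \<open>All stages up to \<open>n\<close> are collected, so that a member of a fixed
    stage \<open>m\<close> through \<open>c z\<close> bounds \<open>h n z\<close> for every
    \<open>n \<ge> m\<close>.\<close>
  define A where "A n z = (\<Union>m\<le>n. {u \<in> \<U> m. c z \<in> u})" for n z
  define h where "h n z = (topspace Y - f ` (topspace X - S n z)) \<inter> \<Inter>((`) f ` A n z)" for n z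
  have h_open: "openin Y (h n z)" if z: "z \<in> D" for n z
  proof -
    have "openin X (S n z)" unfolding S_def using U_open by blast
    then have "closedin Y (f ` (topspace X - S n z))"
      using f(4) unfolding closed_map_def by blast
    moreover have "finite (A n z)" unfolding A_def using U_fin[OF cn[OF z]] by blast
    moreover have "A n z \<noteq> {}" unfolding A_def using U_cover[OF cn[OF z], of n] by blast
    moreover have "openin Y (f ` u)" if "u \<in> A n z" for u
      using that U_open f(3) unfolding A_def open_map_def by blast
    ultimately show ?thesis
      unfolding h_def by (intro openin_Int openin_Inter openin_diff) auto
  qed
  have h_mem: "z \<in> h n z" if z: "z \<in> D" for n z
  proof -
    have "x \<in> S n z" if "x \<in> topspace X" "f x = z" for x
      using U_cover[OF fib, of x n] that z unfolding S_def by blast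
    moreover have "z \<in> f ` u" if "u \<in> A n z" for u
    proof -
      have "c z \<in> u" using that by (auto simp: A_def)
      then show ?thesis using c(2)[OF z] by (metis imageI)
    qed
    moreover have "z \<in> topspace Y" using z by (simp add: D_def nonisolated_def)
    ultimately show ?thesis unfolding h_def by blast
  qed
  have h_sub: "h n z \<subseteq> W" if "u \<in> \<U> m" "m \<le> n" "c z \<in> u" "f ` u \<subseteq> W" for n m z u W
    using that unfolding h_def A_def by blast
  have pull: "\<exists>N. \<forall>n\<ge>N. \<forall>u\<in>\<U> n. x \<in> u \<longrightarrow> f ` u \<subseteq> W"
    if x: "x \<in> topspace X" "f x \<in> D" and W: "openin Y W" "f x \<in> W" for x W
  proof -
    have "openin X {x \<in> topspace X. f x \<in> W}"
      using openin_continuous_map_preimage[OF f(1) W(1)] .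
    moreover have "x \<in> {x \<in> topspace X. f x \<in> W}" using x W by simp
    ultimately obtain N where "\<forall>n\<ge>N. \<forall>u\<in>\<U> n. x \<in> u \<longrightarrow> u \<subseteq> {x \<in> topspace X. f x \<in> W}"
      using U_dev[OF fib[OF x]] by blast
    then have "\<forall>n\<ge>N. \<forall>u\<in>\<U> n. x \<in> u \<longrightarrow> f ` u \<subseteq> W" by fastforce
    then show ?thesis ..
  qed
  \<comment> \<open>If \<open>y\<close> is in \<open>h n z\<close>, the fibre over \<open>y\<close>
    lies in the star of the fibre over \<open>z\<close>. So some \<open>u\<close> in
    \<open>\<U> n\<close> contains both \<open>c y\<close> and a point over \<open>z\<close>, and
    for large \<open>n\<close> its image lies in \<open>W\<close>.\<close>
  have centres: "\<exists>N. \<forall>n\<ge>N. \<forall>z\<in>D. y \<in> h n z \<longrightarrow> z \<in> W"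
    if y: "y \<in> D" and W: "openin Y W" "y \<in> W" for y W
  proof -
    obtain N where N: "\<forall>n\<ge>N. \<forall>u\<in>\<U> n. c y \<in> u \<longrightarrow> f ` u \<subseteq> W"
      using pull[of "c y" W] c[OF y] y W by metis
    have "z \<in> W" if "N \<le> n" "y \<in> h n z" for n z
    proof -
      have "y \<notin> f ` (topspace X - S n z)" using that(2) by (simp add: h_def)
      then have "c y \<in> S n z" using c[OF y] by (metis DiffI imageI)
      then obtain u x where "u \<in> \<U> n" "c y \<in> u" "x \<in> u" "f x = z" by (auto simp: S_def)
      with N that(1) show ?thesis by (metis image_subset_iff)
    qed
    then show ?thesis by blast
  qed
  have h_dev: "\<exists>N. \<forall>n\<ge>N. \<forall>z\<in>D. y \<in> h n z \<longrightarrow> h n z \<subseteq> W"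
    if y: "y \<in> D" and W: "openin Y W" "y \<in> W" for y W
  proof (rule ccontr)
    assume contra: "\<nexists>N. \<forall>n\<ge>N. \<forall>z\<in>D. y \<in> h n z \<longrightarrow> h n z \<subseteq> W"
    define b where "b n z \<longleftrightarrow> z \<in> D \<and> y \<in> h n z \<and> \<not> h n z \<subseteq> W" for n z
    have "\<forall>N. \<exists>n z. N \<le> n \<and> b n z" using contra unfolding b_def by blast
    then obtain k w where kw: "\<And>N. N \<le> k N" "\<And>N. b (k N) (w N)" by metis
    have wD: "w N \<in> D" for N using kw(2) by (simp add: b_def)
    obtain N0 where N0: "\<forall>n\<ge>N0. \<forall>u\<in>\<U> n. c y \<in> u \<longrightarrow> f ` u \<subseteq> W"
      using pull[of "c y" W] c[OF y] y W by metis
    \<comment> \<open>Centres equal to \<open>y\<close> must be excluded: then no single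
      \<open>c (w N)\<close> lies over \<open>y\<close>, and a cluster point over \<open>y\<close>
      survives the removal of finitely many terms.\<close>
    have wy: "w N \<noteq> y" if "N0 \<le> N" for N
    proof
      assume eq: "w N = y"
      obtain u where u: "u \<in> \<U> (k N)" "c y \<in> u" using U_cover[OF cn[OF y]] by blast
      then have "h (k N) y \<subseteq> W"
        using h_sub[OF u(1) order_refl u(2)] N0 order_trans[OF that kw(1)] u by blast
      with kw(2)[of N] eq show False by (simp add: b_def)
    qed
    let ?A = "\<lambda>M. (c \<circ> w) ` {M..}"
    have AX: "?A M \<subseteq> topspace X" for M using c wD by auto
    have "y \<in> Y closure_of (f ` ?A N0)"
      unfolding in_closure_of
    proof (intro conjI allI impI)
      show "y \<in> topspace Y" using y by (simp add: D_def nonisolated_def)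
      fix V assume V: "y \<in> V \<and> openin Y V"
      then obtain N where N: "\<forall>n\<ge>N. \<forall>z\<in>D. y \<in> h n z \<longrightarrow> z \<in> V"
        using centres[OF y, of V] by blast
      let ?M = "max N0 N"
      have "w ?M \<in> V"
        using N kw[of ?M] by (auto simp: b_def)
      moreover have "w ?M = f (c (w ?M))" using c(2)[OF wD] by simp
      then have "w ?M \<in> f ` ?A N0" by (simp add: image_iff) (metis atLeast_iff max.cobounded1)
      ultimately show "\<exists>v. v \<in> f ` ?A N0 \<and> v \<in> V" by blast
    qed
    \<comment> \<open>Closedness of \<open>f\<close> replaces compactness of the fibre: the centres
      accumulate at \<open>y\<close>, so their chosen preimages accumulate at some point over
      \<open>y\<close>.\<close>
    also have "Y closure_of (f ` ?A N0) \<subseteq> f ` (X closure_of ?A N0)"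
      using f(4) AX by (simp add: closed_map_closure_of_image)
    finally obtain x where x: "x \<in> X closure_of ?A N0" "f x = y" by blast
    have xX: "x \<in> topspace X" using x(1) by (simp add: in_closure_of)
    obtain m u where mu: "u \<in> \<U> m" "x \<in> u" "f ` u \<subseteq> W"
    proof -
      have xD: "f x \<in> D" "f x \<in> W" using x(2) y W by auto
      obtain m where m: "\<forall>n\<ge>m. \<forall>u\<in>\<U> n. x \<in> u \<longrightarrow> f ` u \<subseteq> W"
        using pull[OF xX xD(1) W(1) xD(2)] ..
      obtain u where u: "u \<in> \<U> m" "x \<in> u" using U_cover[OF fib[OF xX xD(1)]] by blast
      show thesis by (rule that[OF u]) (use m u in blast)
    qed
    \<comment> \<open>The discarded initial segment is finite, hence closed by T1, and omits
      \<open>x\<close>. Passing to this tail ensures \<open>k N \<ge> m\<close>, as needed to apply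
      \<open>h_sub\<close> to \<open>u\<close>.\<close>
    have "x \<in> X closure_of ?A (max N0 m)"
    proof -
      have "?A N0 \<subseteq> ?A (max N0 m) \<union> (c \<circ> w) ` {N0..<max N0 m}"
        unfolding image_Un[symmetric] by (intro image_mono) auto
      then have "X closure_of ?A N0 \<subseteq> X closure_of ?A (max N0 m) \<union> X closure_of ((c \<circ> w) ` {N0..<max N0 m})"
        by (metis closure_of_Un closure_of_mono)
      moreover have "X closure_of ((c \<circ> w) ` {N0..<max N0 m}) = (c \<circ> w) ` {N0..<max N0 m}"
        using t1 c wD by (intro closure_of_closedin) (auto simp: t1_space_closedin_finite image_subset_iff)
      moreover have "x \<notin> (c \<circ> w) ` {N0..<max N0 m}"
      proof
        assume "x \<in> (c \<circ> w) ` {N0..<max N0 m}"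
        then obtain N where "N0 \<le> N" "x = c (w N)" by auto
        then show False using wy[of N] c(2)[OF wD] x(2) by simp
      qed
      ultimately show ?thesis using x(1) by blast
    qed
    then obtain z where z: "z \<in> ?A (max N0 m)" "z \<in> u"
      using mu(2) U_open[OF mu(1)] unfolding in_closure_of by meson
    then obtain N where N: "max N0 m \<le> N" "c (w N) \<in> u" by auto
    have "m \<le> k N" using N(1) kw(1)[of N] by linarith
    then have "h (k N) (w N) \<subseteq> W"
      using h_sub[OF mu(1) _ N(2) mu(3)] by simp
    with kw(2)[of N] show False by (simp add: b_def)
  qed
  show thesis
    by (rule that[of h]) (use h_open h_mem h_dev in \<open>simp_all add: D_def\<close>)
qed

section \<open>Regularity and the uniform base of the image\<close>

text \<open>In the form with closed neighbourhoods, regularity is pushed forward directly: an open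
  set inside a closed one, both within the preimage of \<open>W\<close>, has an open image inside a
  closed image within \<open>W\<close>.\<close>

lemma regular_space_open_closed_image:
  assumes X: "regular_space X" and f: "continuous_map X Y f" "f ` topspace X = topspace Y"
    "open_map X Y f" "closed_map X Y f"
  shows "regular_space Y"
  unfolding neighbourhood_base_of_closedin[symmetric] neighbourhood_base_of
proof (intro allI impI)
  fix W y assume W: "openin Y W \<and> y \<in> W"
  then have "y \<in> f ` topspace X" using f(2) openin_subset by blast
  then obtain x where x: "x \<in> topspace X" "f x = y" by blast
  let ?W = "{x \<in> topspace X. f x \<in> W}"
  have "openin X ?W \<and> x \<in> ?W"
    using openin_continuous_map_preimage[OF f(1)] W x by blast
  with X obtain U V where "openin X U" "closedin X V" "x \<in> U" "U \<subseteq> V" "V \<subseteq> ?W"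
    unfolding neighbourhood_base_of_closedin[symmetric] neighbourhood_base_of by meson
  then have "openin Y (f ` U)" "closedin Y (f ` V)" "y \<in> f ` U" "f ` U \<subseteq> f ` V" "f ` V \<subseteq> W"
    using f(3,4) x unfolding open_map_def closed_map_def by auto
  then show "\<exists>U V. openin Y U \<and> closedin Y V \<and> y \<in> U \<and> U \<subseteq> V \<and> V \<subseteq> W"
    by blast
qed

text \<open>Each cover by the sets \<open>h n z\<close> gets a point-finite open refinement
  \<open>\<R> n\<close>. These inherit the shrinking of \<open>h\<close>, so the members at
  \<open>y\<close> leaving \<open>W\<close> come from finitely many stages, with finitely many from
  each.\<close>

lemma uniform_base_open_closed_image:
  assumes P: "uniform_base_at_nonisolated_points X \<P>" and t1: "t1_space X"
    and f: "continuous_map X Y f" "f ` topspace X = topspace Y" "open_map X Y f" "closed_map X Y f"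
  shows "\<exists>\<Q>. uniform_base_at_nonisolated_points Y \<Q>"
proof -
  let ?D = "nonisolated Y"
  obtain h where h: "\<And>n z. z \<in> ?D \<Longrightarrow> openin Y (h n z)" "\<And>n z. z \<in> ?D \<Longrightarrow> z \<in> h n z"
    "\<And>y W. y \<in> ?D \<Longrightarrow> openin Y W \<Longrightarrow> y \<in> W \<Longrightarrow>
      \<exists>N::nat. \<forall>n\<ge>N. \<forall>z\<in>?D. y \<in> h n z \<longrightarrow> h n z \<subseteq> W"
    by (rule development_image[OF P t1 f]) (rule that; assumption)
  have "\<exists>\<R>. (\<forall>r\<in>\<R>. openin Y r \<and> (\<exists>z\<in>?D. r \<subseteq> h n z)) \<and> ?D \<subseteq> \<Union>\<R> \<and>
      (\<forall>y\<in>?D. finite {r \<in> \<R>. y \<in> r})" for n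
  proof -
    have V: "openin Y v" if "v \<in> h n ` ?D" for v using that h(1) by blast
    have cover: "?D \<subseteq> \<Union>(h n ` ?D)" using h(2) by blast
    obtain \<R> where "\<And>r. r \<in> \<R> \<Longrightarrow> openin Y r" "\<And>r. r \<in> \<R> \<Longrightarrow> \<exists>v\<in>h n ` ?D. r \<subseteq> v"
      "?D \<subseteq> \<Union>\<R>" "\<And>y. y \<in> ?D \<Longrightarrow> finite {r \<in> \<R>. y \<in> r}"
      by (rule point_finite_refinement[OF closure_preserving_refinable_image[OF P f] h V cover])
        (assumption | rule that)+
    then show ?thesis by (intro exI[of _ \<R>]) simp
  qed
  then have "\<forall>n. \<exists>\<R>. (\<forall>r\<in>\<R>. openin Y r \<and> (\<exists>z\<in>?D. r \<subseteq> h n z)) \<and> ?D \<subseteq> \<Union>\<R> \<and>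
      (\<forall>y\<in>?D. finite {r \<in> \<R>. y \<in> r})" ..
  from choice[OF this] obtain \<R> where "\<forall>n. (\<forall>r\<in>\<R> n. openin Y r \<and> (\<exists>z\<in>?D. r \<subseteq> h n z)) \<and>
      ?D \<subseteq> \<Union>(\<R> n) \<and> (\<forall>y\<in>?D. finite {r \<in> \<R> n. y \<in> r})" ..
  then have R: "\<And>n r. r \<in> \<R> n \<Longrightarrow> openin Y r" "\<And>n r. r \<in> \<R> n \<Longrightarrow> \<exists>z\<in>?D. r \<subseteq> h n z"
    "\<And>n. ?D \<subseteq> \<Union>(\<R> n)" "\<And>n y. y \<in> ?D \<Longrightarrow> finite {r \<in> \<R> n. y \<in> r}"
    by simp_all
  \<comment> \<open>The open singletons supply the base at isolated points and never count as
    exceptions: a singleton containing \<open>y\<close> lies in every \<open>W\<close> around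
    \<open>y\<close>.\<close>
  define \<Q> where "\<Q> = (\<Union>n. \<R> n) \<union> {{y} |y. openin Y {y}}"
  have small: "\<exists>N. \<forall>n\<ge>N. \<forall>r\<in>\<R> n. y \<in> r \<longrightarrow> r \<subseteq> W"
    if "y \<in> ?D" "openin Y W" "y \<in> W" for y W
    using h(3)[OF that] R(2) by (meson order_trans subsetD)
  have "openin Y = arbitrary union_of (\<lambda>U. U \<in> \<Q>)"
  proof -
    have "\<exists>U. U \<in> \<Q> \<and> y \<in> U \<and> U \<subseteq> W" if W: "openin Y W" "y \<in> W" for y W
    proof (cases "y \<in> ?D")
      case True
      obtain N where "\<forall>r\<in>\<R> N. y \<in> r \<longrightarrow> r \<subseteq> W" using small[OF True W] by (meson order_refl)
      moreover obtain r where "r \<in> \<R> N" "y \<in> r" using R(3)[of N] True by blast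
      ultimately have "r \<in> \<Q> \<and> y \<in> r \<and> r \<subseteq> W" unfolding \<Q>_def by blast
      then show ?thesis ..
    next
      case False
      then have "openin Y {y}" using W openin_subset by (auto simp: nonisolated_def)
      with W have "{y} \<in> \<Q> \<and> y \<in> {y} \<and> {y} \<subseteq> W" unfolding \<Q>_def by blast
      then show ?thesis ..
    qed
    moreover have "openin Y U" if "U \<in> \<Q>" for U using that R(1) unfolding \<Q>_def by blast
    ultimately show ?thesis unfolding openin_topology_base_unique by (intro conjI allI impI) simp_all
  qed
  moreover have "finite {q \<in> \<Q>. y \<in> q \<and> \<not> q \<subseteq> W}"
    if y: "y \<in> ?D" and W: "openin Y W" "y \<in> W" for y W
  proof -
    obtain N where N: "\<forall>n\<ge>N. \<forall>r\<in>\<R> n. y \<in> r \<longrightarrow> r \<subseteq> W" using small[OF y W] ..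
    have "{q \<in> \<Q>. y \<in> q \<and> \<not> q \<subseteq> W} \<subseteq> (\<Union>n<N. {r \<in> \<R> n. y \<in> r})"
    proof
      fix q assume q: "q \<in> {q \<in> \<Q>. y \<in> q \<and> \<not> q \<subseteq> W}"
      then obtain n where n: "q \<in> \<R> n" using W unfolding \<Q>_def by auto
      with q N have "n < N" by (metis (mono_tags, lifting) linorder_not_less mem_Collect_eq)
      with n q show "q \<in> (\<Union>n<N. {r \<in> \<R> n. y \<in> r})" by blast
    qed
    moreover have "finite (\<Union>n<N. {r \<in> \<R> n. y \<in> r})" using R(4)[OF y] by blast
    ultimately show ?thesis using finite_subset by blast
  qed
  ultimately show ?thesis unfolding uniform_base_iff by blast
qed

theorem corollary3p6:
  fixes X :: "'a topology" and Y :: "'b topology" and f :: "'a \<Rightarrow> 'b"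
  assumes "Hausdorff_space X" and "Hausdorff_space Y"
    and "continuous_map X Y f" and "f ` topspace X = topspace Y"
    and "open_map X Y f" and "closed_map X Y f"
    and "regular_space X"
    and "\<exists>\<P>. uniform_base_at_nonisolated_points X \<P>"
  shows "regular_space Y \<and> (\<exists>\<Q>. uniform_base_at_nonisolated_points Y \<Q>)"
  using regular_space_open_closed_image[OF assms(7) assms(3-6)]
    uniform_base_open_closed_image[OF _ Hausdorff_imp_t1_space[OF assms(1)] assms(3-6)] assms(8)
  by blast

end
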